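(* Let $k\geq 2$ and let $X$ be a $k$-edge-connected multigraph. Then the complete generalized truncation $Y$ of $X$ is $k$-edge-connected.
   Context: A multigraph may have multiple edges but no loops; it is assumed to have no isolated vertices. Generalized truncation of $X$: take a matching $M_0$ with $|M_0|=|E(X)|$ (on $2|E(X)|$ new vertices) and a bijection $F:E(X)\to M_0$; for each edge $e$ of $X$ with ends $u,v$, label one end of $F(e)$ by $u$ and the other by $v$. For $v\in V(X)$, the cluster $\mathrm{cl}(v)$ is the set of vertices labelled $v$; insert a graph $\mathrm{con}(v)$ (constituent) on $\mathrm{cl}(v)$. The result $F(M_0)\cup\bigcup_v\mathrm{con}(v)$ is a generalized truncation. It is complete if every constituent is a complete graph (this determines it up to isomorphism). A multigraph is $k$-edge-connected if every pair of distinct vertices is joined by $k$ mutually edge-disjoint paths. *)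

theory Defs
  imports Main
begin

record ('v, 'e) pre_multigraph =
  verts :: "'v set"
  edges :: "'e set"
  ends :: "'e \<Rightarrow> 'v set"

text \<open>Isolated vertices are forbidden for multigraphs but must be allowed for constituents: the
  constituent of a vertex of degree 1 has a single vertex and no edge.\<close>

locale loopless_multigraph =
  fixes G :: "('v, 'e) pre_multigraph"
  assumes ends_subset: "e \<in> edges G \<Longrightarrow> ends G e \<subseteq> verts G"
    and card_ends: "e \<in> edges G \<Longrightarrow> card (ends G e) = 2"

locale multigraph = loopless_multigraph G
  for G :: "('v, 'e) pre_multigraph" +
  assumes no_isolated: "v \<in> verts G \<Longrightarrow> \<exists>e\<in>edges G. v \<in> ends G e"

text \<open>In a simple graph an edge is its own set of ends.\<close>

type_synonym 'v pre_graph = "('v, 'v set) pre_multigraph"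

locale simple_graph = loopless_multigraph G
  for G :: "'v pre_graph" +
  assumes ends_id: "ends G = id"

definition complete_graph :: "'v pre_graph \<Rightarrow> bool" where
  "complete_graph G \<longleftrightarrow> simple_graph G \<and>
     (\<forall>x\<in>verts G. \<forall>y\<in>verts G. x \<noteq> y \<longrightarrow> {x, y} \<in> edges G)"

definition matching_graph :: "'v pre_graph \<Rightarrow> bool" where
  "matching_graph M \<longleftrightarrow> simple_graph M \<and> (\<forall>v\<in>verts M. \<exists>!e. e \<in> edges M \<and> v \<in> ends M e)"

text \<open>A path is given by its list of vertices and its list of edges, so that parallel edges are
  distinguished.\<close>

definition is_path ::
  "('v, 'e) pre_multigraph \<Rightarrow> 'v \<Rightarrow> 'v list \<times> 'e list \<Rightarrow> 'v \<Rightarrow> bool" where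
  "is_path G u p v \<longleftrightarrow>
     (case p of (vs, es) \<Rightarrow>
       length vs = Suc (length es) \<and> hd vs = u \<and> last vs = v \<and>
       set vs \<subseteq> verts G \<and> set es \<subseteq> edges G \<and>
       (\<forall>i<length es. ends G (es ! i) = {vs ! i, vs ! Suc i}) \<and>
       distinct vs)"

definition edge_connected :: "nat \<Rightarrow> ('v, 'e) pre_multigraph \<Rightarrow> bool" where
  "edge_connected k G \<longleftrightarrow>
     (\<forall>u\<in>verts G. \<forall>v\<in>verts G. u \<noteq> v \<longrightarrow>
       (\<exists>P :: nat \<Rightarrow> 'v list \<times> 'e list.
          (\<forall>i<k. is_path G u (P i) v) \<and>
          (\<forall>i<k. \<forall>j<k. i \<noteq> j \<longrightarrow> set (snd (P i)) \<inter> set (snd (P j)) = {})))"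

definition cluster :: "'w pre_graph \<Rightarrow> ('w \<Rightarrow> 'v) \<Rightarrow> 'v \<Rightarrow> 'w set" where
  "cluster M lab v = {y \<in> verts M. lab y = v}"

text \<open>\<open>M\<close> is the matching, \<open>F\<close> the bijection from the edges of \<open>X\<close> to those of \<open>M\<close>, \<open>lab\<close> the
  labelling of the vertices of \<open>M\<close> and \<open>con v\<close> the constituent at \<open>v\<close>.\<close>

definition generalized_truncation ::
  "('v, 'e) pre_multigraph \<Rightarrow> 'w pre_graph \<Rightarrow> ('e \<Rightarrow> 'w set) \<Rightarrow> ('w \<Rightarrow> 'v) \<Rightarrow>
   ('v \<Rightarrow> 'w pre_graph) \<Rightarrow> 'w pre_graph \<Rightarrow> bool" where
  "generalized_truncation X M F lab con Y \<longleftrightarrow>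
     matching_graph M \<and>
     bij_betw F (edges X) (edges M) \<and>
     (\<forall>e\<in>edges X. bij_betw lab (ends M (F e)) (ends X e)) \<and>
     (\<forall>v\<in>verts X. simple_graph (con v) \<and> verts (con v) = cluster M lab v) \<and>
     Y = \<lparr>verts = verts M \<union> (\<Union>v\<in>verts X. verts (con v)),
          edges = edges M \<union> (\<Union>v\<in>verts X. edges (con v)),
          ends = id\<rparr>"

definition complete_generalized_truncation ::
  "('v, 'e) pre_multigraph \<Rightarrow> 'w pre_graph \<Rightarrow> bool" where
  "complete_generalized_truncation X Y \<longleftrightarrow>
     (\<exists>M F lab con. generalized_truncation X M F lab con Y \<and>
        (\<forall>v\<in>verts X. complete_graph (con v)))"

end

theory Submission imports Defs begin

text \<open>Two vertices \<open>x\<close>, \<open>y\<close> in different clusters: lift \<open>k\<close> edge-disjoint paths of \<open>X\<close> joining the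
  two labels. A lifted path crosses each intermediate cluster along one constituent edge, and it
  is joined to \<open>x\<close> and to \<open>y\<close> by one edge each in the first and the last cluster. The lifts are
  edge-disjoint because distinct edges of \<open>X\<close> yield disjoint edges of the matching.

  Two vertices \<open>x\<close>, \<open>y\<close> in the cluster of \<open>v\<close>: let \<open>w\<close> be the other end of the edge of \<open>X\<close>
  belonging to \<open>x\<close>, and take \<open>k\<close> edge-disjoint paths of \<open>X\<close> from \<open>w\<close> to \<open>v\<close>. Their last edges
  give \<open>k\<close> distinct vertices of the cluster of \<open>v\<close>. Such a vertex \<open>z\<close> other than \<open>x\<close>, \<open>y\<close> yields
  the path \<open>x z y\<close>; the vertex \<open>x\<close> (if it occurs) yields the edge \<open>xy\<close>; the vertex \<open>y\<close> (if it
  occurs) yields a path from \<open>x\<close> to \<open>y\<close> without edges inside the cluster, namely the matching edge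
  at \<open>x\<close> followed by the lift of the path that arrives at \<open>y\<close>.\<close>

section \<open>Edge sets that connect two vertices\<close>

definition adj :: "('v, 'e) pre_multigraph \<Rightarrow> 'e set \<Rightarrow> ('v \<times> 'v) set" where
  "adj G E = {(p, q). \<exists>e\<in>E. ends G e = {p, q}}"

lemma adj_mono: "E \<subseteq> E' \<Longrightarrow> adj G E \<subseteq> adj G E'"
  by (auto simp: adj_def)

lemma adj_rtrancl_mono: "(a, b) \<in> (adj G E)\<^sup>* \<Longrightarrow> E \<subseteq> E' \<Longrightarrow> (a, b) \<in> (adj G E')\<^sup>*"
  using rtrancl_mono[OF adj_mono] by blast

lemma is_path_Cons:
  assumes "is_path G q (vs, es) b" "ends G e = {p, q}" "p \<in> verts G" "e \<in> edges G" "p \<notin> set vs"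
  shows "is_path G p (p # vs, e # es) b"
proof -
  have "vs \<noteq> []" using assms(1) by (auto simp: is_path_def)
  then show ?thesis
    using assms by (auto simp: is_path_def nth_Cons hd_conv_nth split: nat.splits)
qed

lemma is_path_drop:
  assumes "is_path G q (vs, es) b" "n < length vs"
  shows "is_path G (vs ! n) (drop n vs, drop n es) b"
  using assms by (auto simp: is_path_def hd_drop_conv_nth dest: in_set_dropD)

text \<open>A walk is shortened while it is built from its far end: if the new first vertex already
  lies on the path, everything before that vertex is cut off.\<close>

lemma (in loopless_multigraph) path_if_rtrancl_adj:
  assumes "(a, b) \<in> (adj G E)\<^sup>*" "E \<subseteq> edges G" "b \<in> verts G"
  shows "\<exists>p. is_path G a p b \<and> set (snd p) \<subseteq> E"
  using assms(1)
proof (induction rule: converse_rtrancl_induct)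
  case base
  have "is_path G b ([b], []) b" using assms(3) by (simp add: is_path_def)
  then show ?case by force
next
  case (step p q)
  then obtain vs es where path: "is_path G q (vs, es) b" "set es \<subseteq> E" by auto
  obtain e where e: "e \<in> E" "ends G e = {p, q}" using step by (auto simp: adj_def)
  then have eG: "e \<in> edges G" using assms by auto
  then have p: "p \<in> verts G" using e ends_subset by auto
  show ?case
  proof (cases "p \<in> set vs")
    case True
    then obtain n where "n < length vs" "vs ! n = p" by (auto simp: in_set_conv_nth)
    then have "is_path G p (drop n vs, drop n es) b" using is_path_drop[OF path(1)] by blast
    moreover have "set (drop n es) \<subseteq> E" using path(2) by (auto dest: in_set_dropD)
    ultimately show ?thesis by force
  next
    case False
    have "is_path G p (p # vs, e # es) b" by (rule is_path_Cons[OF path(1) e(2) p eG False])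
    then show ?thesis using path(2) e(1) by (intro exI[of _ "(p # vs, e # es)"]) auto
  qed
qed

text \<open>Replaces paths by disjoint edge sets that each connect the two vertices, so that walks
  can be concatenated below without any care for repeated vertices.\<close>

lemma (in loopless_multigraph) edge_connectedI:
  assumes "\<And>u v. u \<in> verts G \<Longrightarrow> v \<in> verts G \<Longrightarrow> u \<noteq> v \<Longrightarrow>
    \<exists>E. (\<forall>i<k. E i \<subseteq> edges G \<and> (u, v) \<in> (adj G (E i))\<^sup>*) \<and>
        (\<forall>i<k. \<forall>j<k. i \<noteq> j \<longrightarrow> E i \<inter> E j = {})"
  shows "edge_connected k G"
  unfolding edge_connected_def
proof (intro ballI impI)
  fix u v assume uv: "u \<in> verts G" "v \<in> verts G" "u \<noteq> v"
  obtain E where E: "\<forall>i<k. E i \<subseteq> edges G \<and> (u, v) \<in> (adj G (E i))\<^sup>*"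
    "\<forall>i<k. \<forall>j<k. i \<noteq> j \<longrightarrow> E i \<inter> E j = {}" using assms[OF uv] by blast
  have "\<forall>i\<in>{..<k}. \<exists>p. is_path G u p v \<and> set (snd p) \<subseteq> E i"
    using E(1) path_if_rtrancl_adj uv(2) by simp
  then obtain P where "\<forall>i\<in>{..<k}. is_path G u (P i) v \<and> set (snd (P i)) \<subseteq> E i"
    by (meson bchoice)
  then show "\<exists>P. (\<forall>i<k. is_path G u (P i) v) \<and>
      (\<forall>i<k. \<forall>j<k. i \<noteq> j \<longrightarrow> set (snd (P i)) \<inter> set (snd (P j)) = {})"
    using E(2) by (intro exI[of _ P]) (auto, blast)
qed

section \<open>Lifting walks of \<open>X\<close> to the truncation\<close>

text \<open>What the proof needs of a complete truncation, without mention of the matching or the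
  constituents. Since an edge of \<open>Y\<close> is its own set of ends, the sets
  \<open>F e\<close> are pairs that partition the vertices of \<open>Y\<close>.\<close>

locale truncation = X: multigraph X + Y: simple_graph Y
  for X :: "('v, 'e) pre_multigraph" and Y :: "'w pre_graph" +
  fixes F :: "'e \<Rightarrow> 'w set" and lab :: "'w \<Rightarrow> 'v"
  assumes F_edge: "e \<in> edges X \<Longrightarrow> F e \<in> edges Y"
    and F_covers: "y \<in> verts Y \<Longrightarrow> \<exists>e\<in>edges X. y \<in> F e"
    and F_disjoint: "e \<in> edges X \<Longrightarrow> e' \<in> edges X \<Longrightarrow> y \<in> F e \<Longrightarrow> y \<in> F e' \<Longrightarrow> e = e'"
    and bij_lab: "e \<in> edges X \<Longrightarrow> bij_betw lab (F e) (ends X e)"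
    and cluster_complete:
      "a \<in> verts Y \<Longrightarrow> b \<in> verts Y \<Longrightarrow> a \<noteq> b \<Longrightarrow> lab a = lab b \<Longrightarrow> {a, b} \<in> edges Y"
begin

lemma adj_Y: "adj Y E = {(p, q). {p, q} \<in> E}"
  by (auto simp: adj_def Y.ends_id)

lemma F_verts: "e \<in> edges X \<Longrightarrow> y \<in> F e \<Longrightarrow> y \<in> verts Y"
  using Y.ends_subset[OF F_edge] by (auto simp: Y.ends_id)

lemma lab_F: "e \<in> edges X \<Longrightarrow> lab ` F e = ends X e"
  using bij_lab by (auto simp: bij_betw_def)

text \<open>As \<open>X\<close> has no loops, the two ends of a matching edge carry different
  labels.\<close>

lemma F_not_in_cluster: "e \<in> edges X \<Longrightarrow> lab ` F e \<noteq> {l}"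
  using X.card_ends[of e] by (auto simp: lab_F)

lemma F_eq:
  assumes "e \<in> edges X" "ends X e = {u, v}"
  obtains a b where "F e = {a, b}" "lab a = u" "lab b = v"
proof -
  have "card (F e) = 2" using Y.card_ends[OF F_edge[OF assms(1)]] by (simp add: Y.ends_id)
  then obtain a b where ab: "F e = {a, b}" by (auto simp: card_2_iff)
  then have "{lab a, lab b} = {u, v}" using lab_F[OF assms(1)] assms(2) by auto
  then show ?thesis using that[of a b] that[of b a] ab by (auto simp: doubleton_eq_iff insert_commute)
qed

text \<open>The edges of \<open>Y\<close> available to a walk over \<open>es\<close>. Cluster edges
  must join ends of matching edges over \<open>es\<close>, which makes lifts of disjoint edge sets
  disjoint. The set \<open>L\<close> limits the clusters they may lie in, so that edges inside the
  end clusters can be chosen separately.\<close>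

definition lift :: "'e set \<Rightarrow> 'v set \<Rightarrow> 'w set set" where
  "lift es L = F ` es \<union>
     {{p, q} | p q. p \<noteq> q \<and> lab p = lab q \<and> lab p \<in> L \<and> p \<in> \<Union>(F ` es) \<and> q \<in> \<Union>(F ` es)}"

lemma lift_mono: "es \<subseteq> es' \<Longrightarrow> L \<subseteq> L' \<Longrightarrow> lift es L \<subseteq> lift es' L'"
  unfolding lift_def by blast

lemma lift_edges: "es \<subseteq> edges X \<Longrightarrow> lift es L \<subseteq> edges Y"
  unfolding lift_def using F_edge cluster_complete F_verts by fastforce

text \<open>Consecutive edges of the walk meet in a vertex \<open>w\<close> of \<open>X\<close>, so
  their matching edges have ends in the cluster of \<open>w\<close>, and these are equal or
  adjacent. The list \<open>butlast (tl vs)\<close> holds the inner vertices of the walk.\<close>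

lemma lift_walk:
  assumes "length vs = Suc (length es)" "es \<noteq> []" "set es \<subseteq> edges X"
    "\<forall>i<length es. ends X (es ! i) = {vs ! i, vs ! Suc i}"
  shows "\<exists>a b. a \<in> F (hd es) \<and> lab a = hd vs \<and> b \<in> F (last es) \<and> lab b = last vs \<and>
    (a, b) \<in> (adj Y (lift (set es) (set (butlast (tl vs)))))\<^sup>*"
  using assms
proof (induction es arbitrary: vs)
  case (Cons e es)
  obtain u ws where vs: "vs = u # ws" "length ws = Suc (length es)"
    using Cons.prems(1) by (auto simp: length_Suc_conv)
  then obtain w zs where ws: "ws = w # zs" "length zs = length es" by (auto simp: length_Suc_conv)
  have e: "e \<in> edges X" "ends X e = {u, w}"
    using Cons.prems(3) Cons.prems(4)[rule_format, of 0] vs ws by auto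
  obtain a b where ab: "F e = {a, b}" "lab a = u" "lab b = w" by (rule F_eq[OF e])
  let ?L = "lift (set (e # es)) (set (butlast (tl vs)))"
  have step: "(a, b) \<in> adj Y ?L" using ab(1) by (auto simp: adj_Y lift_def)
  show ?case
  proof (cases "es = []")
    case True
    then show ?thesis using step ab vs ws by (intro exI[of _ a] exI[of _ b]) auto
  next
    case False
    have nth: "\<forall>i<length es. ends X (es ! i) = {ws ! i, ws ! Suc i}"
    proof (intro allI impI)
      fix i assume "i < length es"
      then show "ends X (es ! i) = {ws ! i, ws ! Suc i}"
        using Cons.prems(4)[rule_format, of "Suc i"] vs by auto
    qed
    obtain c d where cd: "c \<in> F (hd es)" "lab c = w" "d \<in> F (last es)" "lab d = last ws"
      "(c, d) \<in> (adj Y (lift (set es) (set (butlast (tl ws)))))\<^sup>*"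
      using Cons.IH[OF vs(2) False _ nth] Cons.prems(3) ws by auto
    have zs: "zs \<noteq> []" using False ws by auto
    have "(c, d) \<in> (adj Y ?L)\<^sup>*"
      by (rule adj_rtrancl_mono[OF cd(5)], rule lift_mono)
        (use vs ws in \<open>auto dest: in_set_butlastD\<close>)
    moreover have "(b, c) \<in> (adj Y ?L)\<^sup>*"
    \<comment> \<open>A walk may use one edge twice in succession; then \<open>b\<close> and
      \<open>c\<close> coincide.\<close>
    proof (cases "b = c")
      case False
      have "hd es \<in> set es" using \<open>es \<noteq> []\<close> by simp
      then have "{b, c} \<in> ?L"
        unfolding lift_def using ab cd(1,2) False vs ws zs by auto
      then show ?thesis by (auto simp: adj_Y)
    qed simp
    ultimately have "(a, d) \<in> (adj Y ?L)\<^sup>*" using step by (meson converse_rtrancl_into_rtrancl rtrancl_trans)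
    then show ?thesis using ab cd vs ws False by (intro exI[of _ a] exI[of _ d]) auto
  qed
qed simp

text \<open>The vertices of a path are distinct, so \<open>u\<close> and \<open>v\<close> are not
  among the inner ones and no cluster edge is spent in their clusters.\<close>

lemma lift_path:
  assumes "is_path X u (vs, es) v" "u \<noteq> v"
  shows "\<exists>a b. a \<in> \<Union>(F ` set es) \<and> lab a = u \<and> b \<in> \<Union>(F ` set es) \<and> lab b = v \<and>
    (a, b) \<in> (adj Y (lift (set es) (- {u, v})))\<^sup>*"
proof -
  have path: "length vs = Suc (length es)" "hd vs = u" "last vs = v" "distinct vs"
    "set es \<subseteq> edges X" "\<forall>i<length es. ends X (es ! i) = {vs ! i, vs ! Suc i}"
    using assms(1) by (auto simp: is_path_def)
  have ne: "es \<noteq> []" using path(1-3) assms(2) by (auto simp: length_Suc_conv)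
  obtain ws where ws: "vs = u # ws" using path(1,2) by (cases vs) auto
  then have "ws \<noteq> []" using ne path(1) by auto
  then have "ws = butlast ws @ [v]" using path(3) ws by (metis append_butlast_last_id last_ConsR)
  then have "distinct (u # butlast ws @ [v])" using path(4) ws by metis
  then have "set (butlast (tl vs)) \<subseteq> - {u, v}" using ws by auto
  then have sub: "lift (set es) (set (butlast (tl vs))) \<subseteq> lift (set es) (- {u, v})"
    by (intro lift_mono) auto
  obtain a b where ab: "a \<in> F (hd es)" "lab a = u" "b \<in> F (last es)" "lab b = v"
    "(a, b) \<in> (adj Y (lift (set es) (set (butlast (tl vs)))))\<^sup>*"
    using lift_walk[OF path(1) ne path(5,6)] path(2,3) by blast
  then show ?thesis using adj_rtrancl_mono[OF ab(5) sub] hd_in_set[OF ne] last_in_set[OF ne] by blast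
qed

text \<open>The matching edges over \<open>es\<close> and over \<open>es'\<close> share no vertex,
  so an edge common to both lifts would have to be the empty set.\<close>

lemma lift_disjoint:
  assumes "es \<subseteq> edges X" "es' \<subseteq> edges X" "es \<inter> es' = {}"
  shows "lift es L \<inter> lift es' L' = {}"
proof -
  have T: "\<Union>(F ` es) \<inter> \<Union>(F ` es') = {}" using F_disjoint assms by blast
  have *: "d \<subseteq> \<Union>(F ` s) \<and> d \<noteq> {}" if "d \<in> lift s M" "s \<subseteq> edges X" for d s M
    using that F_not_in_cluster F_edge Y.card_ends[of d] by (fastforce simp: lift_def Y.ends_id)
  show ?thesis using *[OF _ assms(1)] *[OF _ assms(2)] T by blast
qed

lemma lab_lift:
  assumes "es \<subseteq> edges X" "d \<in> lift es L" "lab ` d = {l}"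
  shows "l \<in> L"
  using assms F_not_in_cluster unfolding lift_def by auto

lemma lift_paths:
  assumes "edge_connected k X" "u \<in> verts X" "v \<in> verts X" "u \<noteq> v"
  obtains S a b where "\<And>i. i < k \<Longrightarrow> S i \<subseteq> edges X"
    "\<And>i j. i < k \<Longrightarrow> j < k \<Longrightarrow> i \<noteq> j \<Longrightarrow> S i \<inter> S j = {}"
    "\<And>i. i < k \<Longrightarrow> a i \<in> \<Union>(F ` S i)" "\<And>i. i < k \<Longrightarrow> lab (a i) = u"
    "\<And>i. i < k \<Longrightarrow> b i \<in> \<Union>(F ` S i)" "\<And>i. i < k \<Longrightarrow> lab (b i) = v"
    "\<And>i. i < k \<Longrightarrow> (a i, b i) \<in> (adj Y (lift (S i) (- {u, v})))\<^sup>*"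
proof -
  obtain P where P: "\<And>i. i < k \<Longrightarrow> is_path X u (P i) v"
    "\<And>i j. i < k \<Longrightarrow> j < k \<Longrightarrow> i \<noteq> j \<Longrightarrow> set (snd (P i)) \<inter> set (snd (P j)) = {}"
    using assms unfolding edge_connected_def by meson
  define S where "S i = set (snd (P i))" for i
  have S: "S i \<subseteq> edges X" if "i < k" for i
    using P(1)[OF that] by (auto simp: S_def is_path_def)
  have "\<exists>a b. a \<in> \<Union>(F ` S i) \<and> lab a = u \<and> b \<in> \<Union>(F ` S i) \<and> lab b = v \<and>
      (a, b) \<in> (adj Y (lift (S i) (- {u, v})))\<^sup>*" if "i < k" for i
    unfolding S_def by (rule lift_path[where vs = "fst (P i)"]) (use P(1)[OF that] assms(4) in auto)
  then obtain a b where "\<And>i. i < k \<Longrightarrow> a i \<in> \<Union>(F ` S i)" "\<And>i. i < k \<Longrightarrow> lab (a i) = u"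
    "\<And>i. i < k \<Longrightarrow> b i \<in> \<Union>(F ` S i)" "\<And>i. i < k \<Longrightarrow> lab (b i) = v"
    "\<And>i. i < k \<Longrightarrow> (a i, b i) \<in> (adj Y (lift (S i) (- {u, v})))\<^sup>*"
    by metis
  then show ?thesis using that[of S a b] S P(2) by (simp add: S_def)
qed

section \<open>Disjoint connections between two vertices of the truncation\<close>

lemma different_clusters:
  assumes k: "edge_connected k X" and x: "x \<in> verts Y" and y: "y \<in> verts Y"
    and uv: "lab x \<noteq> lab y" "lab x \<in> verts X" "lab y \<in> verts X"
  shows "\<exists>E. (\<forall>i<k. E i \<subseteq> edges Y \<and> (x, y) \<in> (adj Y (E i))\<^sup>*) \<and>
        (\<forall>i<k. \<forall>j<k. i \<noteq> j \<longrightarrow> E i \<inter> E j = {})"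
proof -
  define u v where "u = lab x" "v = lab y"
  obtain S a b where S: "\<And>i. i < k \<Longrightarrow> S i \<subseteq> edges X"
    and S_disj: "\<And>i j. i < k \<Longrightarrow> j < k \<Longrightarrow> i \<noteq> j \<Longrightarrow> S i \<inter> S j = {}"
    and ab: "\<And>i. i < k \<Longrightarrow> a i \<in> \<Union>(F ` S i)" "\<And>i. i < k \<Longrightarrow> lab (a i) = u"
    "\<And>i. i < k \<Longrightarrow> b i \<in> \<Union>(F ` S i)" "\<And>i. i < k \<Longrightarrow> lab (b i) = v"
    "\<And>i. i < k \<Longrightarrow> (a i, b i) \<in> (adj Y (lift (S i) (- {u, v})))\<^sup>*"
    using lift_paths[OF k uv(2,3,1)] unfolding u_v_def by blast
  \<comment> \<open>\<open>{x, a i}\<close> is not an edge when \<open>a i = x\<close>, hence the intersection.\<close>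
  define E where "E i = (lift (S i) (- {u, v}) \<union> {{x, a i}, {b i, y}}) \<inter> edges Y" for i
  have "(x, y) \<in> (adj Y (E i))\<^sup>*" if i: "i < k" for i
  proof -
    have "(a i, b i) \<in> (adj Y (E i))\<^sup>*"
      by (rule adj_rtrancl_mono[OF ab(5)[OF i]]) (use lift_edges[OF S[OF i]] in \<open>auto simp: E_def\<close>)
    moreover have "a i \<in> verts Y" "b i \<in> verts Y" using ab(1,3)[OF i] S[OF i] F_verts by auto
    then have "x \<noteq> a i \<Longrightarrow> {x, a i} \<in> E i" "b i \<noteq> y \<Longrightarrow> {b i, y} \<in> E i"
      using cluster_complete x y ab(2,4)[OF i] by (simp_all add: E_def u_v_def)
    then have "(x, a i) \<in> (adj Y (E i))\<^sup>*" "(b i, y) \<in> (adj Y (E i))\<^sup>*"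
      unfolding adj_Y by blast+
    ultimately show ?thesis by (meson rtrancl_trans)
  qed
  moreover have "E i \<inter> E j = {}" if ij: "i < k" "j < k" "i \<noteq> j" for i j
  proof (rule ccontr)
    assume "E i \<inter> E j \<noteq> {}"
    then obtain d where d: "d \<in> E i" "d \<in> E j" by blast
    have SS: "S i \<inter> S j = {}" using S_disj ij by blast
    have T: "\<Union>(F ` S i) \<inter> \<Union>(F ` S j) = {}" using F_disjoint S[OF ij(1)] S[OF ij(2)] SS by blast
    have ne: "a i \<noteq> a j" "b i \<noteq> b j" using T ab(1,3)[OF ij(1)] ab(1,3)[OF ij(2)] by (metis disjoint_iff)+
    \<comment> \<open>The labels on \<open>d\<close> tell its kind: only \<open>u\<close> at the
      start, only \<open>v\<close> at the end, and neither of these for an edge of a lift. Hence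
      \<open>d\<close> is of the same kind in \<open>E i\<close> and in \<open>E j\<close>.\<close>
    have u: "lab ` {x, a m} = {u}" and v: "lab ` {b m, y} = {v}" if "m < k" for m
      using ab(2,4)[OF that] by (auto simp: u_v_def)
    have nl: "lab ` d \<noteq> {u} \<and> lab ` d \<noteq> {v}" if "m < k" "d \<in> lift (S m) (- {u, v})" for m
      using lab_lift[OF S[OF that(1)] that(2)] by blast
    have "u \<noteq> v" using uv by (simp add: u_v_def)
    moreover have "d \<notin> lift (S i) (- {u, v}) \<inter> lift (S j) (- {u, v})"
      using lift_disjoint[OF S[OF ij(1)] S[OF ij(2)] SS] by blast
    ultimately have "d = {x, a i} \<and> d = {x, a j} \<or> d = {b i, y} \<and> d = {b j, y}"
      using d u[OF ij(1)] u[OF ij(2)] v[OF ij(1)] v[OF ij(2)] nl[OF ij(1)] nl[OF ij(2)]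
      unfolding E_def by (metis IntE Int_iff UnE insertE singletonD the_elem_eq)
    then show False using ne by (auto simp: doubleton_eq_iff)
  qed
  ultimately show ?thesis by (intro exI[of _ E]) (auto simp: E_def)
qed

lemma same_cluster:
  assumes k: "edge_connected k X" and x: "x \<in> verts Y" and y: "y \<in> verts Y" and xy: "x \<noteq> y"
    and lab: "lab x = v" "lab y = v"
  shows "\<exists>E. (\<forall>i<k. E i \<subseteq> edges Y \<and> (x, y) \<in> (adj Y (E i))\<^sup>*) \<and>
        (\<forall>i<k. \<forall>j<k. i \<noteq> j \<longrightarrow> E i \<inter> E j = {})"
proof -
  obtain e where e: "e \<in> edges X" "x \<in> F e" using F_covers x by blast
  then have "v \<in> ends X e" using lab lab_F by blast
  then obtain w where w: "ends X e = {v, w}" "w \<noteq> v"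
    using X.card_ends[OF e(1)] by (auto simp: card_2_iff doubleton_eq_iff)
  then obtain x' where x': "F e = {x, x'}" "lab x' = w"
    using F_eq[OF e(1) w(1)] e lab by (metis empty_iff insert_iff)
  have vw: "v \<in> verts X" "w \<in> verts X" using X.ends_subset[OF e(1)] w by auto
  obtain S a z where S: "\<And>i. i < k \<Longrightarrow> S i \<subseteq> edges X"
    and S_disj: "\<And>i j. i < k \<Longrightarrow> j < k \<Longrightarrow> i \<noteq> j \<Longrightarrow> S i \<inter> S j = {}"
    and az: "\<And>i. i < k \<Longrightarrow> a i \<in> \<Union>(F ` S i)" "\<And>i. i < k \<Longrightarrow> lab (a i) = w"
    "\<And>i. i < k \<Longrightarrow> z i \<in> \<Union>(F ` S i)" "\<And>i. i < k \<Longrightarrow> lab (z i) = v"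
    "\<And>i. i < k \<Longrightarrow> (a i, z i) \<in> (adj Y (lift (S i) (- {w, v})))\<^sup>*"
    using lift_paths[OF k vw(2,1) w(2)] by blast
  \<comment> \<open>At most one index has \<open>z i = y\<close>, so that index may take all edges
    not inside the cluster of \<open>v\<close>.\<close>
  define outer where "outer = {d \<in> edges Y. lab ` d \<noteq> {v}}"
  \<comment> \<open>Of the paths that do not arrive at \<open>y\<close> only the end
    \<open>z i\<close> is used. Their sets lie inside the cluster of \<open>v\<close>, so it does no
    harm if their lifts contain edges of \<open>outer\<close>, such as the matching edge at
    \<open>x\<close>.\<close>
  define E where "E i = (if z i = y then outer else if z i = x then {{x, y}}
    else {{x, z i}, {z i, y}})" for i
  have zY: "z i \<in> verts Y" if "i < k" for i using az(3)[OF that] S[OF that] F_verts by auto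
  have edges: "E i \<subseteq> edges Y" if i: "i < k" for i
    using cluster_complete[of x y] cluster_complete[of x "z i"] cluster_complete[of "z i" y]
      x y xy lab az(4)[OF i] zY[OF i]
    by (auto simp: E_def outer_def)
  moreover have "(x, y) \<in> (adj Y (E i))\<^sup>*" if i: "i < k" for i
  proof (cases "z i = y")
    case True
    have "lift (S i) (- {w, v}) \<subseteq> outer"
      using lift_edges[OF S[OF i]] lab_lift[OF S[OF i]] unfolding outer_def by blast
    then have "(a i, y) \<in> (adj Y outer)\<^sup>*" using az(5)[OF i] adj_rtrancl_mono True by metis
    \<comment> \<open>Both vertices lie in the cluster of \<open>w\<close>, which differs from
      \<open>v\<close>, so the edge between them belongs to \<open>outer\<close>.\<close>
    moreover have "(x', a i) \<in> (adj Y outer)\<^sup>*"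
    proof (cases "x' = a i")
      case False
      have "x' \<in> verts Y" "a i \<in> verts Y" using F_verts x' e(1) az(1)[OF i] S[OF i] by auto
      then have "{x', a i} \<in> outer"
        using cluster_complete False x'(2) az(2)[OF i] w(2) by (auto simp: outer_def)
      then show ?thesis by (auto simp: adj_Y)
    qed simp
    moreover have "(x, x') \<in> adj Y outer"
      using F_edge[OF e(1)] F_not_in_cluster[OF e(1)] x'(1) by (auto simp: adj_Y outer_def)
    ultimately have "(x, y) \<in> (adj Y outer)\<^sup>*"
      by (meson converse_rtrancl_into_rtrancl rtrancl_trans)
    then show ?thesis using True by (simp add: E_def)
  next
    case False
    show ?thesis
    proof (cases "z i = x")
      case True
      then show ?thesis using xy by (auto simp: E_def adj_Y)
    next
      case z: False
      then have "(x, z i) \<in> adj Y (E i)" "(z i, y) \<in> adj Y (E i)"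
        using False by (auto simp: E_def adj_Y)
      then show ?thesis by (meson converse_rtrancl_into_rtrancl r_into_rtrancl)
    qed
  qed
  moreover have "E i \<inter> E j = {}" if ij: "i < k" "j < k" "i \<noteq> j" for i j
  proof -
    have "\<Union>(F ` S i) \<inter> \<Union>(F ` S j) = {}"
      using F_disjoint S[OF ij(1)] S[OF ij(2)] S_disj[OF ij] by blast
    then have "z i \<noteq> z j" using az(3)[OF ij(1)] az(3)[OF ij(2)] by (metis disjoint_iff)
    then show ?thesis
      using xy lab az(4)[OF ij(1)] az(4)[OF ij(2)]
      by (auto simp: E_def outer_def doubleton_eq_iff)
  qed
  ultimately show ?thesis by (intro exI[of _ E]) simp
qed

lemma edge_connected_truncation:
  assumes "edge_connected k X"
  shows "edge_connected k Y"
proof (rule Y.edge_connectedI)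
  fix x y assume xy: "x \<in> verts Y" "y \<in> verts Y" "x \<noteq> y"
  have "lab z \<in> verts X" if "z \<in> verts Y" for z
    using F_covers[OF that] lab_F X.ends_subset by blast
  then show "\<exists>E. (\<forall>i<k. E i \<subseteq> edges Y \<and> (x, y) \<in> (adj Y (E i))\<^sup>*) \<and>
        (\<forall>i<k. \<forall>j<k. i \<noteq> j \<longrightarrow> E i \<inter> E j = {})"
    using different_clusters[OF assms] same_cluster[OF assms] xy by (cases "lab x = lab y") auto
qed

end

section \<open>From the definition of the truncation to the locale\<close>

text \<open>Constituents live on clusters and add no vertices to those of \<open>M\<close>. The
  matching yields the partition into pairs, and since every label is a vertex of \<open>X\<close>,
  two vertices with equal labels lie in a common complete constituent.\<close>

lemma truncation_if_complete_generalized_truncation: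
  assumes "multigraph X" "generalized_truncation X M F lab con Y"
    "\<forall>v\<in>verts X. complete_graph (con v)"
  shows "truncation X Y F lab"
proof -
  interpret X: multigraph X by fact
  have M: "matching_graph M" and F: "bij_betw F (edges X) (edges M)"
    and lab: "\<And>e. e \<in> edges X \<Longrightarrow> bij_betw lab (ends M (F e)) (ends X e)"
    and con: "\<And>v. v \<in> verts X \<Longrightarrow> simple_graph (con v) \<and> verts (con v) = cluster M lab v"
    and Y: "Y = \<lparr>verts = verts M \<union> (\<Union>v\<in>verts X. verts (con v)),
          edges = edges M \<union> (\<Union>v\<in>verts X. edges (con v)), ends = id\<rparr>"
    using assms(2) unfolding generalized_truncation_def by blast+
  interpret M: simple_graph M using M by (simp add: matching_graph_def)
  have vY: "verts Y = verts M" using con by (auto simp: Y cluster_def)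
  have eY: "edges Y = edges M \<union> (\<Union>v\<in>verts X. edges (con v))" and id: "ends Y = id"
    by (auto simp: Y)
  have con_edge: "d \<subseteq> verts M \<and> card d = 2" if "v \<in> verts X" "d \<in> edges (con v)" for v d
  proof -
    interpret C: simple_graph "con v" using con that by blast
    show ?thesis using C.ends_subset[OF that(2)] C.card_ends[OF that(2)] con[OF that(1)]
      by (auto simp: C.ends_id cluster_def)
  qed
  have M_edge: "d \<subseteq> verts M \<and> card d = 2" if "d \<in> edges M" for d
    using M.ends_subset[OF that] M.card_ends[OF that] by (simp add: M.ends_id)
  have FM: "F e \<in> edges M" if "e \<in> edges X" for e using F that by (auto simp: bij_betw_def)
  have ex1: "\<exists>!d. d \<in> edges M \<and> y \<in> d" if "y \<in> verts M" for y
    using M that by (simp add: matching_graph_def M.ends_id)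
  have cov: "\<exists>e\<in>edges X. y \<in> F e" if y: "y \<in> verts M" for y
  proof -
    obtain d where "d \<in> edges M" "y \<in> d" using ex1[OF y] by blast
    then show ?thesis using F by (auto simp: bij_betw_def)
  qed
  have lab_verts: "lab y \<in> verts X" if y: "y \<in> verts M" for y
  proof -
    obtain e where "e \<in> edges X" "y \<in> F e" using cov[OF y] by blast
    then show ?thesis using lab[of e] X.ends_subset[of e] by (auto simp: bij_betw_def M.ends_id)
  qed
  show ?thesis
  proof
    fix d assume "d \<in> edges Y"
    then show "ends Y d \<subseteq> verts Y" "card (ends Y d) = 2"
      using M_edge con_edge by (auto simp: eY vY id)
  next
    fix e e' y assume e: "e \<in> edges X" "e' \<in> edges X" "y \<in> F e" "y \<in> F e'"
    then have "F e = F e'" using ex1[of y] FM M_edge by blast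
    then show "e = e'" using F e by (auto simp: bij_betw_def dest: inj_onD)
  next
    fix a b assume ab: "a \<in> verts Y" "b \<in> verts Y" "a \<noteq> b" "lab a = lab b"
    then have "{a, b} \<in> edges (con (lab a))"
      using assms(3) con lab_verts unfolding complete_graph_def vY by (auto simp: cluster_def)
    then show "{a, b} \<in> edges Y" using lab_verts ab by (auto simp: eY vY)
  qed (use FM cov lab in \<open>auto simp: eY vY id M.ends_id\<close>)
qed

theorem theorem3p6:
  fixes X :: "('v, 'e) pre_multigraph" and Y :: "'w pre_graph" and k :: nat
  assumes "k \<ge> 2"
    and "multigraph X"
    and "edge_connected k X"
    and "complete_generalized_truncation X Y"
  shows "edge_connected k Y"
proof -
  obtain M F lab con where "generalized_truncation X M F lab con Y"
    "\<forall>v\<in>verts X. complete_graph (con v)"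
    using assms(4) unfolding complete_generalized_truncation_def by blast
  then have "truncation X Y F lab"
    using truncation_if_complete_generalized_truncation assms(2) by blast
  then show ?thesis using truncation.edge_connected_truncation assms(3) by blast
qed

end
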